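(* Let $X$, $Z$ be non-trivial real locally convex topological linear spaces, $C\subseteq Z$ a convex cone with $0\in C$, and $T \colon Z \to X$ an injective continuous linear operator with adjoint $T^*\colon X^*\to Z^*$. Let $f \colon X \to \mathcal G(Z, C)$ be sublinear and $T$-translative, let $z^* \in C^+\setminus\{0\}$ and $\bar x\in X$. If $\partial f_{z^*}(\bar x) \neq \emptyset$ then $$\partial f_{z^*}(\bar x) = \{x^* \in X^* \mid z^* = T^*x^*,\; x^* \in A_f^-,\; S_{(x^*,z^* )}(\bar x) = f(\bar x) \oplus H^+(z^* )\}.$$
   Context: $C^+ = \{z^* \in Z^* \mid \forall z \in C\colon z^*(z)\ge 0\}$. $\mathcal G(Z,C) = \{A \subseteq Z \mid A = \operatorname{cl}\operatorname{co}(A+C)\}$ (containing $\emptyset$ and $Z$); $A + \emptyset=\emptyset$; $A\oplus B = \operatorname{cl}(A+B)$; inf-residuation: $A \ominus B = \{z\in Z\mid B+z\subseteq A\}$ (so $A\ominus\emptyset = Z$). A cone is a set closed under multiplication by scalars $t>0$. $f$ is sublinear if $\operatorname{graph} f=\{(x,z)\mid z\in f(x)\}$ is a convex cone in $X\times Z$. $f$ is $T$-translative if $f(x+Tz) = f(x)+\{z\}$ for all $x\in X$, $z\in Z$. $A_f = \{x\in X\mid 0\in f(x)\}$ and $A_f^- = \{x^*\in X^*\mid\forall x\in A_f\colon x^*(x)\le0\}$. $S_{(x^*,z^* )}(x) = \{z\in Z\mid x^*(x)\le z^*(z)\}$; $H^+(z^* ) = \{z\in Z\mid z^*(z)\ge0\}$.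 Directional derivative: $f'_{z^*}(\bar x,x) = \bigcap_{s>0}\operatorname{cl}\bigcup_{0<t<s}\frac1t\big[(f(\bar x+tx)\oplus H^+(z^* ))\ominus f(\bar x)\big]$. The $z^*$-subdifferential is $\partial f_{z^*}(\bar x) = \{x^*\in X^*\mid\forall x\in X\colon S_{(x^*,z^* )}(x)\supseteq f'_{z^*}(\bar x,x)\}$. *)

theory Defs
  imports "HOL-Analysis.Analysis"
begin

text \<open>
  Real locally convex topological linear spaces.  No separation axiom is imposed.  The condition
  on \<open>V\<close> in the last axiom spells out \<^term>\<open>convex V\<close>, since \<^const>\<open>convex\<close> is not available
  inside a class specification.
\<close>

class locally_convex_space = real_vector + topological_ab_group_add +
  assumes tendsto_scaleR_Pair:
    "LIM p (nhds c \<times>\<^sub>F nhds x). fst p *\<^sub>R snd p :> nhds (c *\<^sub>R x)"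
  assumes convex_nhds_base:
    "open U \<Longrightarrow> x \<in> U \<Longrightarrow> \<exists>V. open V \<and> x \<in> V \<and> V \<subseteq> U \<and>
       (\<forall>y\<in>V. \<forall>z\<in>V. \<forall>u\<ge>0. \<forall>v\<ge>0. u + v = 1 \<longrightarrow> u *\<^sub>R y + v *\<^sub>R z \<in> V)"

lemma locally_convex_space_base:
  fixes x :: "'a::locally_convex_space"
  assumes "open U" "x \<in> U"
  shows "\<exists>V. open V \<and> x \<in> V \<and> V \<subseteq> U \<and> convex V"
  using convex_nhds_base[OF assms] unfolding convex_def by blast

instance real_normed_vector \<subseteq> locally_convex_space
proof
  fix c :: real and x :: 'a
  show "LIM p (nhds c \<times>\<^sub>F nhds x). fst p *\<^sub>R snd p :> nhds (c *\<^sub>R x)"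
    by (intro tendsto_scaleR filterlim_fst filterlim_snd)
next
  fix U :: "'a set" and x :: 'a
  assume "open U" "x \<in> U"
  then obtain e where e: "e > 0" "ball x e \<subseteq> U"
    using open_contains_ball by blast
  moreover have "convex (ball x e)"
    by (rule convex_ball)
  ultimately show "\<exists>V. open V \<and> x \<in> V \<and> V \<subseteq> U \<and>
       (\<forall>y\<in>V. \<forall>z\<in>V. \<forall>u\<ge>0. \<forall>v\<ge>0. u + v = 1 \<longrightarrow> u *\<^sub>R y + v *\<^sub>R z \<in> V)"
    unfolding convex_def by (intro exI[of _ "ball x e"]) simp
qed

text \<open>The topological dual, as the set of continuous linear functionals.\<close>

definition dual_space :: "('a::locally_convex_space \<Rightarrow> real) set" where
  "dual_space = {\<phi>. linear \<phi> \<and> continuous_on UNIV \<phi>}"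

definition dual_adjoint ::
  "('z::locally_convex_space \<Rightarrow> 'x::locally_convex_space) \<Rightarrow> ('x \<Rightarrow> real) \<Rightarrow> 'z \<Rightarrow> real" where
  "dual_adjoint T \<phi> = \<phi> \<circ> T"

text \<open>
  Cones are closed under multiplication by strictly positive scalars only; unlike for
  \<^const>\<open>cone\<close> and \<^const>\<open>conic\<close>, a nonempty cone need not contain \<open>0\<close>.
\<close>

definition pos_cone :: "'a::real_vector set \<Rightarrow> bool" where
  "pos_cone K \<longleftrightarrow> (\<forall>x\<in>K. \<forall>t>0. t *\<^sub>R x \<in> K)"

definition positive_dual_cone :: "'z::locally_convex_space set \<Rightarrow> ('z \<Rightarrow> real) set" where
  "positive_dual_cone C = {\<zeta> \<in> dual_space. \<forall>z\<in>C. \<zeta> z \<ge> 0}"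

definition negative_dual_cone :: "'x::locally_convex_space set \<Rightarrow> ('x \<Rightarrow> real) set" where
  "negative_dual_cone A = {\<phi> \<in> dual_space. \<forall>x\<in>A. \<phi> x \<le> 0}"

text \<open>Here \<open>+\<close> is the elementwise (Minkowski) sum of sets, so \<open>A + {} = {}\<close>.\<close>

definition closed_convex_upper :: "'z::locally_convex_space set \<Rightarrow> 'z set set" where
  "closed_convex_upper C = {A. A = closure (convex hull (A + C))}"

definition closed_sum :: "'z::locally_convex_space set \<Rightarrow> 'z set \<Rightarrow> 'z set" (infixl "\<oplus>" 65) where
  "A \<oplus> B = closure (A + B)"

definition inf_residual :: "'z::locally_convex_space set \<Rightarrow> 'z set \<Rightarrow> 'z set" (infixl "\<ominus>" 65) where
  "A \<ominus> B = {z. B + {z} \<subseteq> A}"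

definition graph_of :: "('x \<Rightarrow> 'z set) \<Rightarrow> ('x \<times> 'z) set" where
  "graph_of f = {(x, z). z \<in> f x}"

definition sublinear :: "('x::real_vector \<Rightarrow> 'z::real_vector set) \<Rightarrow> bool" where
  "sublinear f \<longleftrightarrow> pos_cone (graph_of f) \<and> convex (graph_of f)"

definition translative ::
  "('z::real_vector \<Rightarrow> 'x::real_vector) \<Rightarrow> ('x \<Rightarrow> 'z set) \<Rightarrow> bool" where
  "translative T f \<longleftrightarrow> (\<forall>x z. f (x + T z) = f x + {z})"

definition zero_level_set :: "('x \<Rightarrow> 'z::zero set) \<Rightarrow> 'x set" where
  "zero_level_set f = {x. 0 \<in> f x}"

definition S_map :: "('x \<Rightarrow> real) \<Rightarrow> ('z \<Rightarrow> real) \<Rightarrow> 'x \<Rightarrow> 'z set" where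
  "S_map \<phi> \<zeta> x = {z. \<phi> x \<le> \<zeta> z}"

definition upper_halfspace :: "('z \<Rightarrow> real) \<Rightarrow> 'z set" where
  "upper_halfspace \<zeta> = {z. \<zeta> z \<ge> 0}"

definition dir_deriv ::
  "('z \<Rightarrow> real) \<Rightarrow> ('x::locally_convex_space \<Rightarrow> 'z::locally_convex_space set) \<Rightarrow> 'x \<Rightarrow> 'x \<Rightarrow> 'z set" where
  "dir_deriv \<zeta> f x0 x =
     (\<Inter>s\<in>{0<..}. closure (\<Union>t\<in>{0<..<s}.
        (\<lambda>z. (1 / t) *\<^sub>R z) ` ((f (x0 + t *\<^sub>R x) \<oplus> upper_halfspace \<zeta>) \<ominus> f x0)))"

definition subdifferential ::
  "('z \<Rightarrow> real) \<Rightarrow> ('x::locally_convex_space \<Rightarrow> 'z::locally_convex_space set) \<Rightarrow> 'x \<Rightarrow> ('x \<Rightarrow> real) set" where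
  "subdifferential \<zeta> f x0 =
     {\<phi> \<in> dual_space. \<forall>x. S_map \<phi> \<zeta> x \<supseteq> dir_deriv \<zeta> f x0 x}"

end

theory Submission
  imports Defs
begin

text \<open>
  Scalarize: put \<open>m(x) = inf {\<zeta> z | z \<in> f x}\<close>. Nonemptiness of the subdifferential forces \<open>m(x0)\<close> to
  be finite, and convexity then identifies the subgradients \<open>\<phi>\<close> by the inequality
  \<open>\<phi> (y - x0) + m(x0) \<le> \<zeta> z\<close> on the graph of \<open>f\<close>. Scaling a point of the graph by \<open>t \<rightarrow> \<infinity>\<close> and
  \<open>t \<rightarrow> 0\<close> splits this inequality into \<open>\<phi> y \<le> \<zeta> z\<close> on the graph and \<open>m(x0) = \<phi> x0\<close>. Finally,
  translativity moves a point \<open>(y, z)\<close> of the graph to \<open>(y - T z, 0)\<close>, so that \<open>\<phi> \<le> \<zeta>\<close> on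
  the graph amounts to \<open>\<phi> \<circ> T = \<zeta>\<close> together with \<open>\<phi> \<le> 0\<close> on the zero level set.
\<close>

section \<open>Continuous functionals and sums with their halfspaces\<close>

lemma closed_halfspace_dual:
  assumes "\<zeta> \<in> dual_space"
  shows "closed {z. c \<le> \<zeta> z}"
  using assms unfolding dual_space_def
  by (auto intro!: closed_Collect_le continuous_on_const)

lemma dual_space_surj:
  assumes "\<zeta> \<in> dual_space" "\<zeta> \<noteq> (\<lambda>z. 0)"
  obtains p where "\<zeta> p = c"
proof -
  from assms obtain q where q: "\<zeta> q \<noteq> 0" by auto
  have "\<zeta> ((c / \<zeta> q) *\<^sub>R q) = c"
    using assms(1) q by (simp add: dual_space_def linear_scale)
  then show ?thesis by (rule that)
qed

lemma tendsto_add_inverse_Suc_scaleR: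
  fixes z p :: "'a::locally_convex_space"
  shows "(\<lambda>n. z + inverse (real (Suc n)) *\<^sub>R p) \<longlonglongrightarrow> z"
proof -
  have "(\<lambda>n. (inverse (real (Suc n)), p)) \<longlonglongrightarrow> (0, p)"
    by (intro tendsto_Pair LIMSEQ_inverse_real_of_nat tendsto_const)
  \<comment> \<open>The class axiom states joint continuity of scaling through a product filter, so
    the limit is recast in that form.\<close>
  then have "LIM n sequentially. (inverse (real (Suc n)), p) :> nhds 0 \<times>\<^sub>F nhds p"
    by (simp add: nhds_prod)
  from filterlim_compose[OF tendsto_scaleR_Pair this]
  have "(\<lambda>n. inverse (real (Suc n)) *\<^sub>R p) \<longlonglongrightarrow> 0" by simp
  from tendsto_add[OF tendsto_const this] show ?thesis by simp
qed

text \<open>Up to its boundary, \<open>A + upper_halfspace \<zeta>\<close> is determined by values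
  of \<open>\<zeta>\<close>, and the closure adds that boundary. The form with \<open>e\<close>
  instead of \<open>Inf\<close> also covers empty \<open>A\<close> and values unbounded
  below.\<close>

lemma mem_closed_sum_halfspace_iff:
  assumes \<zeta>: "\<zeta> \<in> dual_space" "\<zeta> \<noteq> (\<lambda>z. 0)"
  shows "z \<in> A \<oplus> upper_halfspace \<zeta> \<longleftrightarrow> (\<forall>e>0. \<exists>a\<in>A. \<zeta> a < \<zeta> z + e)"
proof
  have lin: "linear \<zeta>" using \<zeta> by (simp add: dual_space_def)
  assume z: "z \<in> A \<oplus> upper_halfspace \<zeta>"
  show "\<forall>e>0. \<exists>a\<in>A. \<zeta> a < \<zeta> z + e"
  proof (rule ccontr)
    assume "\<not> ?thesis"
    \<comment> \<open>A gap \<open>e\<close> confines the sum to the closed halfspace at level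
      \<open>\<zeta> z + e\<close>, which excludes \<open>z\<close>.\<close>
    then obtain e where e: "e > 0" "\<And>a. a \<in> A \<Longrightarrow> \<zeta> z + e \<le> \<zeta> a" by force
    then have "A + upper_halfspace \<zeta> \<subseteq> {y. \<zeta> z + e \<le> \<zeta> y}"
      by (fastforce simp: set_plus_def upper_halfspace_def linear_add[OF lin])
    then have "closure (A + upper_halfspace \<zeta>) \<subseteq> {y. \<zeta> z + e \<le> \<zeta> y}"
      by (rule closure_minimal) (rule closed_halfspace_dual[OF \<zeta>(1)])
    then show False using z e(1) by (auto simp: closed_sum_def)
  qed
next
  have lin: "linear \<zeta>" using \<zeta> by (simp add: dual_space_def)
  assume *: "\<forall>e>0. \<exists>a\<in>A. \<zeta> a < \<zeta> z + e"
  \<comment> \<open>Moving along \<open>p\<close> raises the value by exactly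
    \<open>1/(n+1)\<close>, enough to exceed that of some \<open>a \<in> A\<close>; these points of
    the sum converge to \<open>z\<close>.\<close>
  obtain p where p: "\<zeta> p = 1" using dual_space_surj[OF \<zeta>] .
  have mem: "z + inverse (real (Suc n)) *\<^sub>R p \<in> closure (A + upper_halfspace \<zeta>)" for n
  proof -
    let ?y = "z + inverse (real (Suc n)) *\<^sub>R p"
    obtain a where a: "a \<in> A" "\<zeta> a < \<zeta> z + inverse (real (Suc n))"
      using * by (metis inverse_positive_iff_positive of_nat_0_less_iff zero_less_Suc)
    have "\<zeta> (?y - a) \<ge> 0"
      using a p by (simp add: linear_diff[OF lin] linear_add[OF lin] linear_scale[OF lin])
    then have "a + (?y - a) \<in> A + upper_halfspace \<zeta>"
      using a by (intro set_plus_intro) (auto simp: upper_halfspace_def)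
    then show ?thesis using closure_subset by fastforce
  qed
  show "z \<in> A \<oplus> upper_halfspace \<zeta>"
    unfolding closed_sum_def
    by (rule Lim_in_closed_set[OF closed_closure always_eventually[OF allI[OF mem]]
          sequentially_bot tendsto_add_inverse_Suc_scaleR])
qed

lemma closed_sum_halfspace_eq:
  assumes \<zeta>: "\<zeta> \<in> dual_space" "\<zeta> \<noteq> (\<lambda>z. 0)" and A: "A \<noteq> {}" "bdd_below (\<zeta> ` A)"
  shows "A \<oplus> upper_halfspace \<zeta> = {z. Inf (\<zeta> ` A) \<le> \<zeta> z}"
proof -
  have "(\<forall>e>0. \<exists>a\<in>A. \<zeta> a < \<zeta> z + e) \<longleftrightarrow> Inf (\<zeta> ` A) \<le> \<zeta> z" for z
  proof
    assume *: "\<forall>e>0. \<exists>a\<in>A. \<zeta> a < \<zeta> z + e"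
    show "Inf (\<zeta> ` A) \<le> \<zeta> z"
    proof (rule field_le_epsilon)
      fix e :: real assume "e > 0"
      then obtain a where a: "a \<in> A" "\<zeta> a < \<zeta> z + e" using * by blast
      have "Inf (\<zeta> ` A) \<le> \<zeta> a" using a A by (intro cInf_lower) auto
      then show "Inf (\<zeta> ` A) \<le> \<zeta> z + e" using a by simp
    qed
  next
    assume le: "Inf (\<zeta> ` A) \<le> \<zeta> z"
    show "\<forall>e>0. \<exists>a\<in>A. \<zeta> a < \<zeta> z + e"
    proof (intro allI impI)
      fix e :: real assume "e > 0"
      then have "Inf (\<zeta> ` A) < \<zeta> z + e" using le by simp
      then show "\<exists>a\<in>A. \<zeta> a < \<zeta> z + e"
        using cInf_lessD[of "\<zeta> ` A" "\<zeta> z + e"] A by auto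
    qed
  qed
  then show ?thesis using mem_closed_sum_halfspace_iff[OF \<zeta>] by blast
qed

section \<open>Subgradients as affine bounds on the graph\<close>

text \<open>If \<open>f x0\<close> is empty or \<open>\<zeta>\<close> is unbounded below on it, the
  residual of \<open>f x0 \<oplus> upper_halfspace \<zeta>\<close> by \<open>f x0\<close> is the
  whole space. So is then the derivative in direction 0, which no subgradient allows, as
  \<open>S_map \<phi> \<zeta> 0\<close> is a proper halfspace.\<close>

lemma subdifferential_nonempty_imp_finite:
  assumes \<zeta>: "\<zeta> \<in> dual_space" "\<zeta> \<noteq> (\<lambda>z. 0)" and ne: "subdifferential \<zeta> f x0 \<noteq> {}"
  shows "f x0 \<noteq> {} \<and> bdd_below (\<zeta> ` f x0)"
proof (rule ccontr)
  assume inf: "\<not> ?thesis"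
  have residual: "(f x0 \<oplus> upper_halfspace \<zeta>) \<ominus> f x0 = UNIV"
  proof (cases "f x0 = {}")
    case True
    then show ?thesis by (simp add: inf_residual_def set_plus_def)
  next
    case False
    with inf have "\<exists>a\<in>f x0. \<zeta> a < c" for c
      by (auto simp: bdd_below_def not_le)
    then have "f x0 \<oplus> upper_halfspace \<zeta> = UNIV"
      using mem_closed_sum_halfspace_iff[OF \<zeta>] by blast
    then show ?thesis by (simp add: inf_residual_def)
  qed
  from ne obtain \<phi> where "\<phi> \<in> subdifferential \<zeta> f x0" by blast
  then have \<phi>: "\<phi> \<in> dual_space" "dir_deriv \<zeta> f x0 0 \<subseteq> S_map \<phi> \<zeta> 0"
    by (simp_all add: subdifferential_def)
  obtain p where p: "\<zeta> p = -1" using dual_space_surj[OF \<zeta>] .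
  have "p \<in> dir_deriv \<zeta> f x0 0"
    unfolding dir_deriv_def
  proof (intro INT_I)
    fix s :: real assume s: "s \<in> {0<..}"
    have "p \<in> (\<Union>t\<in>{0<..<s}. (\<lambda>z. (1 / t) *\<^sub>R z) `
        ((f (x0 + t *\<^sub>R 0) \<oplus> upper_halfspace \<zeta>) \<ominus> f x0))"
      using s by (intro UN_I[of "s/2"] image_eqI[where x = "(s/2) *\<^sub>R p"]) (simp_all add: residual)
    then show "p \<in> closure (\<Union>t\<in>{0<..<s}. (\<lambda>z. (1 / t) *\<^sub>R z) `
        ((f (x0 + t *\<^sub>R 0) \<oplus> upper_halfspace \<zeta>) \<ominus> f x0))"
      by (rule subsetD[OF closure_subset])
  qed
  then show False
    using \<phi> p by (auto simp: S_map_def dual_space_def linear_0)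
qed

text \<open>By convexity, \<open>m(x0 + t x) \<le> (1 - t) m(x0) + t \<zeta> z\<close> for
  \<open>0 < t < 1\<close>, so the difference quotient never exceeds \<open>\<zeta> u\<close>. Hence
  \<open>u\<close> lies in each union already before the closure.\<close>

lemma dir_deriv_memI:
  assumes \<zeta>: "\<zeta> \<in> dual_space" "\<zeta> \<noteq> (\<lambda>z. 0)" and conv: "convex (graph_of f)"
    and fin: "f x0 \<noteq> {}" "bdd_below (\<zeta> ` f x0)"
    and z: "z \<in> f (x0 + x)" and u: "\<zeta> u = \<zeta> z - Inf (\<zeta> ` f x0)"
  shows "u \<in> dir_deriv \<zeta> f x0 x"
  unfolding dir_deriv_def
proof (intro INT_I)
  fix s :: real assume s: "s \<in> {0<..}"
  have lin: "linear \<zeta>" using \<zeta> by (simp add: dual_space_def)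
  define m where "m = Inf (\<zeta> ` f x0)"
  \<comment> \<open>\<open>s/2\<close> keeps \<open>t\<close> below \<open>s\<close>, and
    \<open>1/2\<close> keeps it below 1 for the convex combination.\<close>
  define t where "t = min (s/2) (1/2)"
  have t: "t > 0" "t < s" "t < 1" using s by (auto simp: t_def)
  have "t *\<^sub>R u \<in> (f (x0 + t *\<^sub>R x) \<oplus> upper_halfspace \<zeta>) \<ominus> f x0"
    unfolding inf_residual_def
  proof (intro CollectI subsetI)
    fix y assume "y \<in> f x0 + {t *\<^sub>R u}"
    then obtain w where w: "w \<in> f x0" "y = w + t *\<^sub>R u" by (auto simp: set_plus_def)
    have m: "m \<le> \<zeta> w" unfolding m_def using w fin by (intro cInf_lower) auto
    show "y \<in> f (x0 + t *\<^sub>R x) \<oplus> upper_halfspace \<zeta>"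
      unfolding mem_closed_sum_halfspace_iff[OF \<zeta>]
    proof (intro allI impI)
      fix e :: real assume e: "e > 0"
      then have "Inf (\<zeta> ` f x0) < m + e" by (simp add: m_def)
      then obtain v where v: "v \<in> f x0" "\<zeta> v < m + e"
        using cInf_lessD[of "\<zeta> ` f x0" "m + e"] fin by auto
      have "(1 - t) *\<^sub>R (x0, v) + t *\<^sub>R (x0 + x, z) \<in> graph_of f"
        using t v z by (intro convexD[OF conv]) (auto simp: graph_of_def)
      moreover have "(1 - t) *\<^sub>R x0 + t *\<^sub>R (x0 + x) = x0 + t *\<^sub>R x"
        by (simp add: algebra_simps)
      ultimately have mem: "(1 - t) *\<^sub>R v + t *\<^sub>R z \<in> f (x0 + t *\<^sub>R x)"
        by (simp add: graph_of_def)
      \<comment> \<open>\<open>v\<close> is minimal up to \<open>e\<close>; the weight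
        \<open>1 - t < 1\<close> turns this into an error strictly below \<open>e\<close>.\<close>
      have "(1 - t) * \<zeta> v \<le> (1 - t) * (m + e)" using v t by (intro mult_left_mono) auto
      moreover have "t * e > 0" using t e by simp
      ultimately have "(1 - t) * \<zeta> v < (1 - t) * m + e"
        by (simp add: algebra_simps)
      moreover have "t * \<zeta> z = t * \<zeta> u + t * m" using u by (simp add: m_def right_diff_distrib)
      ultimately have "(1 - t) * \<zeta> v + t * \<zeta> z < \<zeta> w + t * \<zeta> u + e"
        using m by (simp add: algebra_simps)
      then have "\<zeta> ((1 - t) *\<^sub>R v + t *\<^sub>R z) < \<zeta> y + e"
        using w by (simp add: linear_add[OF lin] linear_scale[OF lin])
      with mem show "\<exists>a\<in>f (x0 + t *\<^sub>R x). \<zeta> a < \<zeta> y + e" by blast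
    qed
  qed
  then have "u \<in> (\<Union>t\<in>{0<..<s}. (\<lambda>z. (1 / t) *\<^sub>R z) `
      ((f (x0 + t *\<^sub>R x) \<oplus> upper_halfspace \<zeta>) \<ominus> f x0))"
    using t by (intro UN_I[of t] image_eqI[where x = "t *\<^sub>R u"]) simp_all
  then show "u \<in> closure (\<Union>t\<in>{0<..<s}. (\<lambda>z. (1 / t) *\<^sub>R z) `
      ((f (x0 + t *\<^sub>R x) \<oplus> upper_halfspace \<zeta>) \<ominus> f x0))"
    by (rule subsetD[OF closure_subset])
qed

text \<open>One direction tests the derivative in direction \<open>y - x0\<close> at the point from
  \<open>dir_deriv_memI\<close>. Conversely, the inequality at \<open>x0 + t x\<close> bounds every
  difference quotient below by \<open>\<phi> x\<close>, a bound that survives the closure.\<close>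

lemma mem_subdifferential_iff:
  assumes \<zeta>: "\<zeta> \<in> dual_space" "\<zeta> \<noteq> (\<lambda>z. 0)" and conv: "convex (graph_of f)"
    and fin: "f x0 \<noteq> {}" "bdd_below (\<zeta> ` f x0)" and \<phi>: "\<phi> \<in> dual_space"
  shows "\<phi> \<in> subdifferential \<zeta> f x0 \<longleftrightarrow>
    (\<forall>(y, z)\<in>graph_of f. \<phi> (y - x0) + Inf (\<zeta> ` f x0) \<le> \<zeta> z)"
proof
  assume sub: "\<phi> \<in> subdifferential \<zeta> f x0"
  show "\<forall>(y, z)\<in>graph_of f. \<phi> (y - x0) + Inf (\<zeta> ` f x0) \<le> \<zeta> z"
  proof (clarify)
    fix y z assume "(y, z) \<in> graph_of f"
    then have z: "z \<in> f (x0 + (y - x0))" by (simp add: graph_of_def)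
    obtain u where u: "\<zeta> u = \<zeta> z - Inf (\<zeta> ` f x0)" using dual_space_surj[OF \<zeta>] .
    have "u \<in> dir_deriv \<zeta> f x0 (y - x0)"
      using \<zeta> conv fin z u by (rule dir_deriv_memI)
    with sub have "\<phi> (y - x0) \<le> \<zeta> u" by (auto simp: subdifferential_def S_map_def)
    then show "\<phi> (y - x0) + Inf (\<zeta> ` f x0) \<le> \<zeta> z" using u by simp
  qed
next
  assume ineq: "\<forall>(y, z)\<in>graph_of f. \<phi> (y - x0) + Inf (\<zeta> ` f x0) \<le> \<zeta> z"
  have lin: "linear \<zeta>" "linear \<phi>" using \<zeta> \<phi> by (simp_all add: dual_space_def)
  have "dir_deriv \<zeta> f x0 x \<subseteq> S_map \<phi> \<zeta> x" for x
  proof -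
    \<comment> \<open>The member \<open>s = 1\<close> of the intersection, which contains the
      derivative.\<close>
    let ?U = "\<Union>t\<in>{0<..<1}. (\<lambda>z. (1 / t) *\<^sub>R z) `
        ((f (x0 + t *\<^sub>R x) \<oplus> upper_halfspace \<zeta>) \<ominus> f x0)"
    have "?U \<subseteq> {z. \<phi> x \<le> \<zeta> z}"
    proof clarify
      fix t r assume t: "t \<in> {0<..<1::real}"
        and r: "r \<in> (f (x0 + t *\<^sub>R x) \<oplus> upper_halfspace \<zeta>) \<ominus> f x0"
      \<comment> \<open>The left side is a lower bound of \<open>\<zeta>\<close> on
        \<open>f x0\<close>. Both infima then cancel, leaving
        \<open>t \<phi> x \<le> \<zeta> r\<close>.\<close>
      have "t * \<phi> x + Inf (\<zeta> ` f x0) - \<zeta> r \<le> Inf (\<zeta> ` f x0)"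
      proof (intro cINF_greatest fin(1))
        fix w assume "w \<in> f x0"
        with r have "w + r \<in> f (x0 + t *\<^sub>R x) \<oplus> upper_halfspace \<zeta>"
          by (auto simp: inf_residual_def set_plus_def)
        then have ex: "\<forall>e>0. \<exists>v\<in>f (x0 + t *\<^sub>R x). \<zeta> v < \<zeta> (w + r) + e"
          by (simp add: mem_closed_sum_halfspace_iff[OF \<zeta>])
        have "t * \<phi> x + Inf (\<zeta> ` f x0) \<le> \<zeta> (w + r)"
        proof (rule field_le_epsilon)
          fix e :: real assume "e > 0"
          with ex obtain v where v: "v \<in> f (x0 + t *\<^sub>R x)" "\<zeta> v < \<zeta> (w + r) + e" by blast
          with ineq have "\<phi> (t *\<^sub>R x) + Inf (\<zeta> ` f x0) \<le> \<zeta> v"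
            by (fastforce simp: graph_of_def)
          with v show "t * \<phi> x + Inf (\<zeta> ` f x0) \<le> \<zeta> (w + r) + e"
            by (simp add: linear_scale[OF lin(2)])
        qed
        then show "t * \<phi> x + Inf (\<zeta> ` f x0) - \<zeta> r \<le> \<zeta> w"
          by (simp add: linear_add[OF lin(1)])
      qed
      then show "\<phi> x \<le> \<zeta> ((1 / t) *\<^sub>R r)"
        using t by (simp add: linear_scale[OF lin(1)] field_simps)
    qed
    then have "closure ?U \<subseteq> {z. \<phi> x \<le> \<zeta> z}"
      by (rule closure_minimal) (rule closed_halfspace_dual[OF \<zeta>(1)])
    moreover have "dir_deriv \<zeta> f x0 x \<subseteq> closure ?U"
      unfolding dir_deriv_def by (rule INT_lower) simp
    ultimately show ?thesis unfolding S_map_def by blast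
  qed
  then show "\<phi> \<in> subdifferential \<zeta> f x0" using \<phi> by (simp add: subdifferential_def)
qed

section \<open>Bounds on cones and translativity\<close>

text \<open>A positive gap \<open>g x - h x\<close> would outgrow \<open>c\<close> along multiples
  of \<open>x\<close>; applying \<open>g \<le> h\<close> to \<open>- x\<close> reverses the
  inequality.\<close>

lemma linear_le_imp_eq:
  fixes g h :: "'a::real_vector \<Rightarrow> real"
  assumes "linear g" "linear h" and le: "\<And>x. g x \<le> h x + c"
  shows "g = h"
proof
  have "g x \<le> h x" for x
  proof (rule ccontr)
    assume "\<not> ?thesis"
    then have d: "g x - h x > 0" by simp
    then obtain n :: nat where n: "c < of_nat n * (g x - h x)" using reals_Archimedean3 by blast
    have "g (real n *\<^sub>R x) \<le> h (real n *\<^sub>R x) + c" by (rule le)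
    then show False using n assms by (simp add: linear_scale algebra_simps)
  qed
  from this this[of "- x" for x] show "g x = h x" for x
    using assms by (simp add: linear_neg antisym)
qed

lemma cone_affine_bound_split:
  fixes \<phi> :: "'a::real_vector \<Rightarrow> real" and \<zeta> :: "'b::real_vector \<Rightarrow> real"
  assumes "linear \<phi>" "linear \<zeta>" and cone: "pos_cone K"
    and bound: "\<And>y z. (y, z) \<in> K \<Longrightarrow> \<phi> y + c \<le> \<zeta> z" and mem: "(y, z) \<in> K"
  shows "\<phi> y \<le> \<zeta> z" "c \<le> 0"
proof -
  have scaled: "t * \<phi> y + c \<le> t * \<zeta> z" if "t > 0" for t
  proof -
    have "t *\<^sub>R (y, z) \<in> K" using cone mem that unfolding pos_cone_def by blast
    then have "\<phi> (t *\<^sub>R y) + c \<le> \<zeta> (t *\<^sub>R z)" by (intro bound) simp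
    then show ?thesis using assms(1,2) by (simp add: linear_scale)
  qed
  show "\<phi> y \<le> \<zeta> z"
  proof (rule ccontr)
    assume "\<not> ?thesis"
    then have d: "\<phi> y - \<zeta> z > 0" by simp
    \<comment> \<open>Chosen so that the scaled bound reads
      \<open>\<bar>c\<bar> + 1 + c \<le> 0\<close>, which is impossible.\<close>
    define t where "t = (\<bar>c\<bar> + 1) / (\<phi> y - \<zeta> z)"
    have "t > 0" using d by (simp add: t_def)
    moreover have "t * (\<phi> y - \<zeta> z) = \<bar>c\<bar> + 1" using d by (simp add: t_def)
    ultimately show False using scaled[of t] by (simp add: algebra_simps)
  qed
  show "c \<le> 0"
  proof (rule field_le_epsilon)
    fix e :: real assume e: "e > 0"
    \<comment> \<open>Small enough that \<open>t (\<zeta> z - \<phi> y) \<le> e\<close>; the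
      \<open>+ 1\<close> avoids a zero denominator.\<close>
    define t where "t = e / (\<bar>\<zeta> z - \<phi> y\<bar> + 1)"
    have t: "t > 0" using e by (simp add: t_def)
    have "t * (\<zeta> z - \<phi> y) \<le> t * (\<bar>\<zeta> z - \<phi> y\<bar> + 1)" using t by (intro mult_left_mono) auto
    also have "\<dots> = e" by (simp add: t_def add_nonneg_eq_0_iff)
    finally show "c \<le> 0 + e" using scaled[OF t] by (simp add: algebra_simps)
  qed
qed

lemma translative_bound_on_graph_iff:
  assumes tr: "translative T f" and "linear T" and \<phi>: "\<phi> \<in> dual_space" and "linear \<zeta>"
    and ne: "f x0 \<noteq> {}"
  shows "(\<forall>(y, z)\<in>graph_of f. \<phi> y \<le> \<zeta> z) \<longleftrightarrow>
    \<zeta> = dual_adjoint T \<phi> \<and> \<phi> \<in> negative_dual_cone (zero_level_set f)"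
proof
  have lin: "linear \<phi>" using \<phi> by (simp add: dual_space_def)
  assume le: "\<forall>(y, z)\<in>graph_of f. \<phi> y \<le> \<zeta> z"
  from ne obtain z0 where z0: "z0 \<in> f x0" by blast
  \<comment> \<open>Translating one graph point by arbitrary \<open>w\<close> bounds the adjoint by
    \<open>\<zeta>\<close> up to a constant independent of \<open>w\<close>; for linear functionals
    this forces equality.\<close>
  have "dual_adjoint T \<phi> w \<le> \<zeta> w + (\<zeta> z0 - \<phi> x0)" for w
  proof -
    have "z0 + w \<in> f (x0 + T w)" using tr z0 by (auto simp: translative_def set_plus_def)
    then have "\<phi> (x0 + T w) \<le> \<zeta> (z0 + w)" using le by (auto simp: graph_of_def)
    then show ?thesis
      using lin \<open>linear \<zeta>\<close> by (simp add: dual_adjoint_def linear_add)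
  qed
  moreover have "linear (dual_adjoint T \<phi>)"
    unfolding dual_adjoint_def using \<open>linear T\<close> lin by (rule linear_compose)
  ultimately have "dual_adjoint T \<phi> = \<zeta>" using \<open>linear \<zeta>\<close> by (intro linear_le_imp_eq)
  moreover have "\<phi> \<in> negative_dual_cone (zero_level_set f)"
    using le \<phi> \<open>linear \<zeta>\<close>
    by (fastforce simp: negative_dual_cone_def zero_level_set_def graph_of_def linear_0)
  ultimately show "\<zeta> = dual_adjoint T \<phi> \<and> \<phi> \<in> negative_dual_cone (zero_level_set f)" by simp
next
  have lin: "linear \<phi>" using \<phi> by (simp add: dual_space_def)
  assume R: "\<zeta> = dual_adjoint T \<phi> \<and> \<phi> \<in> negative_dual_cone (zero_level_set f)"
  show "\<forall>(y, z)\<in>graph_of f. \<phi> y \<le> \<zeta> z"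
  proof clarify
    fix y z assume "(y, z) \<in> graph_of f"
    \<comment> \<open>Translation by \<open>- z\<close> carries the graph point to height 0, where
      the sign condition on \<open>\<phi>\<close> applies.\<close>
    then have "z + (- z) \<in> f y + {- z}" by (intro set_plus_intro) (auto simp: graph_of_def)
    moreover have "f (y + T (- z)) = f y + {- z}" using tr by (simp add: translative_def)
    ultimately have "y + T (- z) \<in> zero_level_set f" by (simp add: zero_level_set_def)
    then have "\<phi> (y + T (- z)) \<le> 0" using R by (auto simp: negative_dual_cone_def)
    then show "\<phi> y \<le> \<zeta> z"
      using R lin \<open>linear T\<close> by (simp add: dual_adjoint_def linear_add linear_neg linear_diff)
  qed
qed

theorem corollary5p23:
  fixes C :: "'z::locally_convex_space set"
    and T :: "'z \<Rightarrow> 'x::locally_convex_space"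
    and f :: "'x \<Rightarrow> 'z set"
    and zs :: "'z \<Rightarrow> real"
    and x0 :: 'x
  assumes "\<exists>x::'x. x \<noteq> 0" and "\<exists>z::'z. z \<noteq> 0"
    and "pos_cone C" and "convex C" and "0 \<in> C"
    and "linear T" and "continuous_on UNIV T" and "inj T"
    and "\<forall>x. f x \<in> closed_convex_upper C"
    and "sublinear f" and "translative T f"
    and "zs \<in> positive_dual_cone C - {\<lambda>z. 0}"
    and "subdifferential zs f x0 \<noteq> {}"
  shows "subdifferential zs f x0 =
    {xs \<in> dual_space. zs = dual_adjoint T xs \<and>
       xs \<in> negative_dual_cone (zero_level_set f) \<and>
       S_map xs zs x0 = f x0 \<oplus> upper_halfspace zs}"
proof -
  have zs: "zs \<in> dual_space" "zs \<noteq> (\<lambda>z. 0)" using assms(12) by (auto simp: positive_dual_cone_def)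
  then have lz: "linear zs" by (simp add: dual_space_def)
  have cone: "pos_cone (graph_of f)" and conv: "convex (graph_of f)"
    using assms(10) by (auto simp: sublinear_def)
  define m where "m = Inf (zs ` f x0)"
  have fin: "f x0 \<noteq> {}" "bdd_below (zs ` f x0)"
    using subdifferential_nonempty_imp_finite[OF zs assms(13)] by auto
  \<comment> \<open>Both sets are upper halfspaces of \<open>zs\<close>, at levels
    \<open>xs x0\<close> and \<open>m\<close>. As \<open>zs\<close> attains both levels, equal sets
    have equal levels.\<close>
  have S_iff: "S_map xs zs x0 = f x0 \<oplus> upper_halfspace zs \<longleftrightarrow> xs x0 = m" for xs
  proof
    assume "S_map xs zs x0 = f x0 \<oplus> upper_halfspace zs"
    then have eq: "xs x0 \<le> zs z \<longleftrightarrow> m \<le> zs z" for z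
      unfolding closed_sum_halfspace_eq[OF zs fin] S_map_def m_def by blast
    obtain p q where "zs p = xs x0" "zs q = m" using dual_space_surj[OF zs] by metis
    with eq[of p] eq[of q] show "xs x0 = m" by simp
  next
    assume "xs x0 = m"
    then show "S_map xs zs x0 = f x0 \<oplus> upper_halfspace zs"
      unfolding closed_sum_halfspace_eq[OF zs fin] S_map_def m_def by simp
  qed
  have "xs \<in> subdifferential zs f x0 \<longleftrightarrow>
      (\<forall>(y, z)\<in>graph_of f. xs y \<le> zs z) \<and> xs x0 = m" if xs: "xs \<in> dual_space" for xs
  proof -
    have lx: "linear xs" using xs by (simp add: dual_space_def)
    \<comment> \<open>Linearity collects the base point into the constant \<open>m - xs x0\<close>,
      the \<open>c\<close> of \<open>cone_affine_bound_split\<close>.\<close>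
    have "xs \<in> subdifferential zs f x0 \<longleftrightarrow>
        (\<forall>(y, z)\<in>graph_of f. xs y + (m - xs x0) \<le> zs z)"
      unfolding mem_subdifferential_iff[OF zs conv fin xs] m_def
      by (simp add: linear_diff[OF lx] algebra_simps)
    also have "\<dots> \<longleftrightarrow> (\<forall>(y, z)\<in>graph_of f. xs y \<le> zs z) \<and> xs x0 = m"
    proof (safe, goal_cases)
      case (1 y z)
      show ?case by (rule cone_affine_bound_split(1)[OF lx lz cone _ 1(2)]) (use 1(1) in auto)
    next
      case 2
      from fin obtain z0 where z0: "(x0, z0) \<in> graph_of f" by (auto simp: graph_of_def)
      have bound: "xs y + (m - xs x0) \<le> zs z" if "(y, z) \<in> graph_of f" for y z
        using 2 that by auto
      \<comment> \<open>The sign of the constant gives \<open>m \<le> xs x0\<close>; the homogeneous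
        bound at \<open>x0\<close>, after taking the infimum over \<open>f x0\<close>, gives the
        reverse.\<close>
      have "m - xs x0 \<le> 0" by (rule cone_affine_bound_split(2)[OF lx lz cone bound z0])
      moreover have "xs x0 \<le> m"
        unfolding m_def
      proof (intro cINF_greatest fin(1))
        fix z assume "z \<in> f x0"
        then have "(x0, z) \<in> graph_of f" by (simp add: graph_of_def)
        then show "xs x0 \<le> zs z"
          using cone_affine_bound_split(1)[OF lx lz cone bound] by blast
      qed
      ultimately show ?case by simp
    qed auto
    finally show ?thesis .
  qed
  then have "xs \<in> subdifferential zs f x0 \<longleftrightarrow> zs = dual_adjoint T xs \<and>
       xs \<in> negative_dual_cone (zero_level_set f) \<and>
       S_map xs zs x0 = f x0 \<oplus> upper_halfspace zs" if "xs \<in> dual_space" for xs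
    using translative_bound_on_graph_iff[OF assms(11,6) that lz fin(1)] S_iff that by blast
  moreover have "subdifferential zs f x0 \<subseteq> dual_space" by (auto simp: subdifferential_def)
  ultimately show ?thesis by blast
qed

end
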